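(* Let $X=\{x_1,\dots,x_n\}$ be a finite metric space with distance matrix $D$, and suppose that $X$ admits a microscopic weighting $\widehat{\mathbf{w}}=\lim_{t\to 0^+}\mathbf{w}(t)$. Then the following statements hold. (1) $X$ has the one-point property: $\lim_{t\to 0^+}\mu_X(t)=1$. (2) The magnitude function $\mu_X$ is differentiable at zero. (3) The microscopic weighting $\widehat{\mathbf{w}}$ is a gauging for $D$ with concentration $\mu_X'(0)$; that is, $\mathbf{1}^{\mathrm T}\widehat{\mathbf{w}}=1$ and $D\widehat{\mathbf{w}}=\mu_X'(0)\,\mathbf{1}$.
   Context: Let $X=\{x_1,\dots,x_n\}$ be a finite (nonempty) metric space with metric $d$. Its distance matrix is $D=(d(x_i,x_j))_{i,j}$. For $t>0$, its similarity matrix at scale $t$ is $Z(t)=(e^{-t d(x_i,x_j)})_{i,j}$. Write $\mathbf{1}=(1,\dots,1)^{\mathrm T}\in\mathbb{R}^n$. A weighting at scale $t$ is a vector $\mathbf{w}(t)$ with $Z(t)\mathbf{w}(t)=\mathbf{1}$; the magnitude function is $\mu_X(t)=\mathbf{1}^{\mathrm T}\mathbf{w}(t)$ for any weighting at scale $t$ (the value is independent of the choice), and $\mu_X(t)=\infty$ if there is none. For all sufficiently small $t>0$ the matrix $Z(t)$ is invertible, so $\mathbf{w}(t)=Z(t)^{-1}\mathbf{1}$ is the unique weighting and $\mu_X(t)$ is finite. $X$ admits a microscopic weighting if $\widehat{\mathbf{w}}:=\lim_{t\to0^+}\mathbf{w}(t)$ exists componentwise in $\mathbb{R}^n$; then $\widehat{\mathbf{w}}$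 is the microscopic weighting. Differentiability of $\mu_X$ at zero means one-sided differentiability at $0$ of $\mu_X$ extended by $\mu_X(0):=\lim_{t\to0^+}\mu_X(t)$; $\mu_X'(0)$ denotes this derivative (equivalently $\lim_{t\to 0^+}\mu_X'(t)$). A gauging for a symmetric real $n\times n$ matrix $A$ is a vector $\mathbf{v}\in\mathbb{R}^n$ with $\mathbf{1}^{\mathrm T}\mathbf{v}=1$ and $A\mathbf{v}=c\mathbf{1}$ for some $c\in\mathbb{R}$; $c$ is the concentration of the gauging. *)

theory Defs
  imports "HOL-Analysis.Analysis"
begin

text \<open>
  A finite metric space is a \<^const>\<open>Metric_space\<close> \<open>M\<close> \<open>d\<close> whose points are enumerated without
  repetition by \<open>x :: 'n::finite \<Rightarrow> 'a\<close>. The all-ones vector is \<open>1 :: real ^ 'n\<close>, so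
  \<open>1 \<bullet> v\<close> is the sum of the entries of \<open>v\<close>.
\<close>

definition distance_matrix :: "('a \<Rightarrow> 'a \<Rightarrow> real) \<Rightarrow> ('n::finite \<Rightarrow> 'a) \<Rightarrow> real ^ 'n ^ 'n" where
  "distance_matrix d x = (\<chi> i j. d (x i) (x j))"

definition similarity_matrix ::
    "('a \<Rightarrow> 'a \<Rightarrow> real) \<Rightarrow> ('n::finite \<Rightarrow> 'a) \<Rightarrow> real \<Rightarrow> real ^ 'n ^ 'n" where
  "similarity_matrix d x t = (\<chi> i j. exp (- t * d (x i) (x j)))"

definition is_weighting ::
    "('a \<Rightarrow> 'a \<Rightarrow> real) \<Rightarrow> ('n::finite \<Rightarrow> 'a) \<Rightarrow> real \<Rightarrow> real ^ 'n \<Rightarrow> bool" where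
  "is_weighting d x t w \<longleftrightarrow> similarity_matrix d x t *v w = 1"

text \<open>
  The choice of weighting is immaterial: \<open>Z\<close> is symmetric, so \<open>1 \<bullet> w = Z w' \<bullet> w = w' \<bullet> Z w = w' \<bullet> 1\<close>
  for any two weightings \<open>w\<close>, \<open>w'\<close> at the same scale.
\<close>
definition magnitude :: "('a \<Rightarrow> 'a \<Rightarrow> real) \<Rightarrow> ('n::finite \<Rightarrow> 'a) \<Rightarrow> real \<Rightarrow> ereal" where
  "magnitude d x t =
    (if \<exists>w. is_weighting d x t w then ereal (1 \<bullet> (SOME w. is_weighting d x t w)) else \<infinity>)"

text \<open>
  Meaningful only when the similarity matrix is invertible, which is the case for all sufficiently
  small \<open>t > 0\<close>; only the limit \<open>t \<rightarrow> 0+\<close> is used.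
\<close>
definition weighting_vector ::
    "('a \<Rightarrow> 'a \<Rightarrow> real) \<Rightarrow> ('n::finite \<Rightarrow> 'a) \<Rightarrow> real \<Rightarrow> real ^ 'n" where
  "weighting_vector d x t = matrix_inv (similarity_matrix d x t) *v 1"

definition is_microscopic_weighting ::
    "('a \<Rightarrow> 'a \<Rightarrow> real) \<Rightarrow> ('n::finite \<Rightarrow> 'a) \<Rightarrow> real ^ 'n \<Rightarrow> bool" where
  "is_microscopic_weighting d x w \<longleftrightarrow> (weighting_vector d x \<longlongrightarrow> w) (at_right 0)"

definition one_point_property :: "('a \<Rightarrow> 'a \<Rightarrow> real) \<Rightarrow> ('n::finite \<Rightarrow> 'a) \<Rightarrow> bool" where
  "one_point_property d x \<longleftrightarrow> (magnitude d x \<longlongrightarrow> 1) (at_right 0)"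

definition extended_magnitude :: "('a \<Rightarrow> 'a \<Rightarrow> real) \<Rightarrow> ('n::finite \<Rightarrow> 'a) \<Rightarrow> real \<Rightarrow> ereal" where
  "extended_magnitude d x t =
    (if t = 0 then Lim (at_right 0) (magnitude d x) else magnitude d x t)"

text \<open>
  Derivatives need a real-valued function. The conversion sends \<open>\<infinity>\<close> to \<open>0\<close>, which is harmless for
  the derivative at \<open>0\<close> when the magnitude is finite on some \<open>(0, \<epsilon>)\<close> with a finite limit at \<open>0\<close>;
  the one-point property guarantees both.
\<close>
definition real_magnitude :: "('a \<Rightarrow> 'a \<Rightarrow> real) \<Rightarrow> ('n::finite \<Rightarrow> 'a) \<Rightarrow> real \<Rightarrow> real" where
  "real_magnitude d x t = real_of_ereal (extended_magnitude d x t)"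

definition magnitude_differentiable_at_zero ::
    "('a \<Rightarrow> 'a \<Rightarrow> real) \<Rightarrow> ('n::finite \<Rightarrow> 'a) \<Rightarrow> bool" where
  "magnitude_differentiable_at_zero d x \<longleftrightarrow>
    real_magnitude d x differentiable (at 0 within {0..})"

definition magnitude_deriv_zero :: "('a \<Rightarrow> 'a \<Rightarrow> real) \<Rightarrow> ('n::finite \<Rightarrow> 'a) \<Rightarrow> real" where
  "magnitude_deriv_zero d x = vector_derivative (real_magnitude d x) (at 0 within {0..})"

definition is_gauging :: "real ^ 'n ^ 'n \<Rightarrow> real ^ 'n::finite \<Rightarrow> real \<Rightarrow> bool"
  \<comment> \<open>the last argument is the concentration\<close> where
  "is_gauging A v c \<longleftrightarrow> transpose A = A \<and> 1 \<bullet> v = 1 \<and> A *v v = c *\<^sub>R 1"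

end

theory Submission
  imports Defs "HOL-Complex_Analysis.Conformal_Mappings" "HOL-Real_Asymp.Real_Asymp"
begin

text \<open>
  The determinant of \<open>Z(t)\<close> is an entire function of \<open>t\<close> tending to \<open>1\<close> as \<open>t \<rightarrow> \<infinity>\<close>, so its zeros
  are isolated and \<open>Z(t) w(t) = 1\<close> holds for all small \<open>t > 0\<close>. Letting \<open>t \<rightarrow> 0\<close> gives that the
  entries of the microscopic weighting sum to \<open>1\<close>. Row \<open>i\<close> of the weighting equation reads
  \<open>\<mu>(t) - 1 = \<Sum>j. w\<^sub>j(t) (1 - exp (- t d\<^sub>i\<^sub>j))\<close>; dividing by \<open>t\<close> shows that \<open>\<mu>'(0)\<close> exists and equals
  the \<open>i\<close>-th entry of \<open>D w\<close>, for every \<open>i\<close>.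
\<close>

lemma tendsto_det:
  fixes A :: "'b \<Rightarrow> real ^ 'n ^ 'n"
  assumes "\<And>i j. ((\<lambda>t. A t $ i $ j) \<longlongrightarrow> B $ i $ j) F"
  shows "((\<lambda>t. det (A t)) \<longlongrightarrow> det B) F"
  unfolding det_def by (intro tendsto_intros assms)

text \<open>Distinct points lie at positive distance, so the off-diagonal entries decay and the
  matrix tends to the identity. This rules out a determinant that vanishes identically.\<close>

lemma det_similarity_matrix_at_top:
  fixes x :: "'n::finite \<Rightarrow> 'a"
  assumes "Metric_space M d" "bij_betw x UNIV M"
  shows "((\<lambda>t. det (similarity_matrix d x t)) \<longlongrightarrow> 1) at_top"
proof -
  interpret Metric_space M d by fact
  have xM: "x i \<in> M" for i
    using assms(2) by (auto simp: bij_betw_def)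
  have "((\<lambda>t. similarity_matrix d x t $ i $ j) \<longlongrightarrow> (mat 1 :: real ^ 'n ^ 'n) $ i $ j) at_top" for i j
  proof (cases "i = j")
    case True
    then show ?thesis
      using xM by (simp add: similarity_matrix_def mat_def)
  next
    case False
    then have "x i \<noteq> x j"
      using assms(2) by (auto simp: bij_betw_def inj_def)
    then have "d (x i) (x j) > 0"
      using xM by simp
    then have "((\<lambda>t. exp (- t * d (x i) (x j))) \<longlongrightarrow> 0) at_top"
      by real_asymp
    then show ?thesis
      using False by (simp add: similarity_matrix_def mat_def)
  qed
  then have "((\<lambda>t. det (similarity_matrix d x t)) \<longlongrightarrow> det (mat 1 :: real ^ 'n ^ 'n)) at_top"
    by (rule tendsto_det)
  then show ?thesis
    by (simp only: det_I)
qed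

lemma eventually_invertible_similarity_matrix:
  fixes x :: "'n::finite \<Rightarrow> 'a"
  assumes "Metric_space M d" "bij_betw x UNIV M"
  shows "\<forall>\<^sub>F t in at_right 0. invertible (similarity_matrix d x t)"
proof (rule ccontr)
  assume not_ev: "\<not> ?thesis"
  \<comment> \<open>\<open>F\<close> extends the determinant to complex scales, where the identity
    theorem for holomorphic functions applies.\<close>
  define F where "F z = det (\<chi> i j. exp (- z * of_real (d (x i) (x j))) :: complex ^ 'n ^ 'n)"
    for z :: complex
  have F_real: "F (of_real t) = of_real (det (similarity_matrix d x t))" for t
    unfolding F_def det_def similarity_matrix_def by (simp flip: exp_of_real)
  have hol: "F holomorphic_on UNIV"
    unfolding F_def det_def by (simp, intro holomorphic_intros)
  define U :: "complex set" where "U = of_real ` {t. t > 0 \<and> det (similarity_matrix d x t) = 0}"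
  \<comment> \<open>If invertibility fails arbitrarily close to \<open>0\<close> from the right, the
    real zeros of \<open>F\<close> accumulate at \<open>0\<close>.\<close>
  have "0 islimpt U"
    unfolding islimpt_approachable
  proof (intro allI impI)
    fix e :: real
    assume "e > 0"
    then obtain t where "0 < t" "t < e" "\<not> invertible (similarity_matrix d x t)"
      using not_ev unfolding eventually_at_right_field by blast
    then show "\<exists>z\<in>U. z \<noteq> 0 \<and> dist z 0 < e"
      by (intro bexI[of _ "of_real t"]) (auto simp: U_def invertible_det_nz)
  qed
  moreover have "\<forall>z\<in>U. F z = 0"
    by (auto simp: U_def F_real)
  ultimately have "F z = 0" for z
    using analytic_continuation[OF hol open_UNIV connected_UNIV subset_UNIV UNIV_I] by blast
  then have "det (similarity_matrix d x t) = 0" for t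
    using F_real[of t] by simp
  then show False
    using det_similarity_matrix_at_top[OF assms] by (simp add: tendsto_const_iff)
qed

lemma inner_one_vec: "1 \<bullet> v = (\<Sum>j\<in>UNIV. v $ j)" for v :: "real ^ 'n"
  by (simp add: inner_vec_def)

lemma matrix_inv_inverse:
  assumes "invertible A"
  shows "A ** matrix_inv A = mat 1" "matrix_inv A ** A = mat 1"
  using someI_ex[OF assms[unfolded invertible_def]] by (simp_all add: matrix_inv_def)

text \<open>The equivalence gives existence and uniqueness of the solution together; both are needed
  to evaluate the choice in \<open>magnitude\<close>.\<close>

lemma matrix_inv_mult_vector:
  fixes A :: "real ^ 'n ^ 'n"
  assumes "invertible A"
  shows "A *v v = b \<longleftrightarrow> v = matrix_inv A *v b"
  using matrix_inv_inverse[OF assms]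
  by (metis matrix_vector_mul_assoc matrix_vector_mul_lid)

lemma is_weighting_invertible:
  assumes "invertible (similarity_matrix d x t)"
  shows "is_weighting d x t v \<longleftrightarrow> v = weighting_vector d x t"
  unfolding is_weighting_def weighting_vector_def by (rule matrix_inv_mult_vector[OF assms])

lemma magnitude_invertible:
  assumes "invertible (similarity_matrix d x t)"
  shows "magnitude d x t = ereal (1 \<bullet> weighting_vector d x t)"
proof -
  \<comment> \<open>As an equality of predicates, this turns the \<open>SOME\<close> in
    \<open>magnitude\<close> into a choice from a singleton.\<close>
  have "is_weighting d x t = (\<lambda>v. v = weighting_vector d x t)"
    using is_weighting_invertible[OF assms] by blast
  then show ?thesis
    by (simp add: magnitude_def)
qed

lemma is_weighting_row:
  assumes "is_weighting d x t v"
  shows "(\<Sum>j\<in>UNIV. exp (- t * d (x i) (x j)) * v $ j) = 1"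
proof -
  have "(similarity_matrix d x t *v v) $ i = 1"
    using assms by (simp add: is_weighting_def)
  then show ?thesis
    by (simp add: similarity_matrix_def matrix_vector_mult_def)
qed

text \<open>The row \<open>i\<close> is arbitrary in the last claim, whereas
  \<open>real_magnitude\<close> does not depend on it; uniqueness of the derivative will then make
  \<open>D w\<close> constant.\<close>

lemma microscopic_weighting_limits:
  fixes x :: "'n::finite \<Rightarrow> 'a" and w :: "real ^ 'n"
  assumes "\<forall>\<^sub>F t in at_right 0. invertible (similarity_matrix d x t)"
    and "is_microscopic_weighting d x w"
  shows "1 \<bullet> w = 1"
    and "(magnitude d x \<longlongrightarrow> 1) (at_right 0)"
    and "(real_magnitude d x has_vector_derivative (distance_matrix d x *v w) $ i)
      (at 0 within {0..})"
proof -
  let ?W = "weighting_vector d x"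
  have W: "((\<lambda>t. ?W t $ j) \<longlongrightarrow> w $ j) (at_right 0)" for j
    using assms(2) unfolding is_microscopic_weighting_def by (intro tendsto_intros)
  have row: "\<forall>\<^sub>F t in at_right 0. (\<Sum>j\<in>UNIV. exp (- t * d (x i) (x j)) * ?W t $ j) = 1" for i
    using assms(1) by eventually_elim (simp only: is_weighting_row is_weighting_invertible)
  \<comment> \<open>In the limit all exponentials become \<open>1\<close>, so a single row equation
    already yields the sum of the entries of \<open>w\<close>.\<close>
  have "((\<lambda>t. \<Sum>j\<in>UNIV. exp (- t * d (x i) (x j)) * ?W t $ j) \<longlongrightarrow>
      (\<Sum>j\<in>UNIV. exp (- 0 * d (x i) (x j)) * w $ j)) (at_right 0)"
    by (intro tendsto_intros W)
  moreover have "((\<lambda>t. \<Sum>j\<in>UNIV. exp (- t * d (x i) (x j)) * ?W t $ j) \<longlongrightarrow> 1) (at_right 0)"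
    using row by (rule tendsto_eventually)
  ultimately have "(\<Sum>j\<in>UNIV. exp (- 0 * d (x i) (x j)) * w $ j) = 1"
    by (rule tendsto_unique[OF trivial_limit_at_right_real])
  then show sum_w: "1 \<bullet> w = 1"
    by (simp add: inner_one_vec)
  have mag: "\<forall>\<^sub>F t in at_right 0. magnitude d x t = ereal (1 \<bullet> ?W t)"
    using assms(1) by eventually_elim (rule magnitude_invertible)
  have "((\<lambda>t. 1 \<bullet> ?W t) \<longlongrightarrow> 1 \<bullet> w) (at_right 0)"
    using assms(2) unfolding is_microscopic_weighting_def by (intro tendsto_intros)
  then have "((\<lambda>t. ereal (1 \<bullet> ?W t)) \<longlongrightarrow> 1) (at_right 0)"
    unfolding sum_w by (simp add: one_ereal_def)
  then show lim: "(magnitude d x \<longlongrightarrow> 1) (at_right 0)"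
    using mag by (simp add: tendsto_cong)
  have at_0: "real_magnitude d x 0 = 1"
    using tendsto_Lim[OF trivial_limit_at_right_real lim]
    by (simp add: real_magnitude_def extended_magnitude_def)
  \<comment> \<open>The value \<open>1\<close> at zero is replaced by the left side of row
    \<open>i\<close>. Positivity of \<open>t\<close> keeps \<open>extended_magnitude\<close> away
    from its special value at \<open>0\<close>.\<close>
  have quot: "\<forall>\<^sub>F t in at_right 0. (\<Sum>j\<in>UNIV. (1 - exp (- t * d (x i) (x j))) / t * ?W t $ j) =
      (real_magnitude d x t - real_magnitude d x 0) / (t - 0)"
    using mag row[of i] eventually_at_right_less[of 0]
  proof eventually_elim
    case (elim t)
    then have "real_magnitude d x t = (\<Sum>j\<in>UNIV. ?W t $ j)"
      by (simp add: real_magnitude_def extended_magnitude_def inner_one_vec)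
    moreover have "(\<Sum>j\<in>UNIV. (1 - exp (- t * d (x i) (x j))) / t * ?W t $ j) =
        ((\<Sum>j\<in>UNIV. ?W t $ j) - (\<Sum>j\<in>UNIV. exp (- t * d (x i) (x j)) * ?W t $ j)) / t"
      by (simp add: sum_subtractf[symmetric] sum_divide_distrib left_diff_distrib diff_divide_distrib)
    ultimately show ?case
      using elim(2) at_0 by simp
  qed
  \<comment> \<open>Only the exponentials are differentiated; for the weights, convergence is
    enough.\<close>
  have "((\<lambda>t. (1 - exp (- t * a)) / t) \<longlongrightarrow> a) (at_right 0)" for a :: real
    by real_asymp
  then have "((\<lambda>t. \<Sum>j\<in>UNIV. (1 - exp (- t * d (x i) (x j))) / t * ?W t $ j) \<longlongrightarrow>
      (\<Sum>j\<in>UNIV. d (x i) (x j) * w $ j)) (at_right 0)"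
    by (intro tendsto_sum tendsto_mult W)
  moreover have "(\<Sum>j\<in>UNIV. d (x i) (x j) * w $ j) = (distance_matrix d x *v w) $ i"
    by (simp add: distance_matrix_def matrix_vector_mult_def)
  ultimately show "(real_magnitude d x has_vector_derivative (distance_matrix d x *v w) $ i)
      (at 0 within {0..})"
    using quot by (simp add: has_real_derivative_iff_has_vector_derivative[symmetric]
        has_field_derivative_iff at_within_Ici_at_right tendsto_cong)
qed

theorem theorem3p1:
  fixes M :: "'a set" and d :: "'a \<Rightarrow> 'a \<Rightarrow> real"
    and x :: "'n::finite \<Rightarrow> 'a" and w :: "real ^ 'n"
  assumes "Metric_space M d"
    and "bij_betw x UNIV M"
    and "is_microscopic_weighting d x w"
  shows "one_point_property d x
    \<and> magnitude_differentiable_at_zero d x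
    \<and> is_gauging (distance_matrix d x) w (magnitude_deriv_zero d x)"
proof -
  interpret Metric_space M d by fact
  note inv = eventually_invertible_similarity_matrix[OF assms(1,2)]
  note deriv = microscopic_weighting_limits(3)[OF inv assms(3)]
  \<comment> \<open>Nontriviality of this filter makes the one-sided derivative unique.\<close>
  have "at 0 within {0..} \<noteq> (bot :: real filter)"
    by (simp add: at_within_Ici_at_right)
  then have "magnitude_deriv_zero d x = (distance_matrix d x *v w) $ i" for i
    unfolding magnitude_deriv_zero_def using deriv by (rule vector_derivative_within)
  then have "distance_matrix d x *v w = magnitude_deriv_zero d x *\<^sub>R 1"
    by (simp add: vec_eq_iff)
  moreover have "transpose (distance_matrix d x) = distance_matrix d x"
    by (simp add: transpose_def distance_matrix_def commute)
  moreover have "magnitude_differentiable_at_zero d x"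
    unfolding magnitude_differentiable_at_zero_def
    using deriv by (rule differentiableI_vector)
  ultimately show ?thesis
    using microscopic_weighting_limits(1,2)[OF inv assms(3)]
    by (simp add: one_point_property_def is_gauging_def)
qed

end
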